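(* Consider a finite protocol instance $\hat{\mathcal{P}}$ with symmetry group $G$, initial-state formula $\hat{Init}$, transition relation $\hat{T}$ and safety property $\hat{P}$, satisfying $\hat{Init}^{\gamma}\equiv\hat{Init}$, $\hat{T}^{\gamma}\equiv\hat{T}$ and $\hat{P}^{\gamma}\equiv\hat{P}$ for every $\gamma\in G$. Let $F_{i-1}$ be a frame of the SymIC3 algorithm on $\hat{\mathcal{P}}$ and let $\varphi$ be a quantifier-free clause over the state variables. If $F_{i-1}\wedge\hat{T}\wedge\neg[\varphi]'$ is unsatisfiable, then $F_{i-1}\wedge\hat{T}\wedge\neg[\varphi^{L(G)}]'$ is also unsatisfiable.
   Context: A finite protocol instance has finitely many sorts, each a finite set of distinct constants (dependent sorts, e.g. sorts whose constants are named subsets of another sort, are permuted in the induced way). State variables are Boolean variables $r(c_1,\dots,c_k)$ (protocol relations instantiated with sort constants); for a formula $\psi$, $\psi'$ denotes $\psi$ with every state variable replaced by its next-state (primed) copy. The symmetry group is $G=\prod_{\mathsf{s}}Sym(\mathsf{s})$ over the independent sorts; for $\gamma\in G$, $\psi^{\gamma}$ is obtained from $\psi$ by replacing each sort constant $c$ by $\gamma(c)$. For a clause $\varphi$, the logical orbit is $\varphi^{L(G)}=\bigwedge_{\gamma\in G}\varphi^{\gamma}$. SymIC3 is IC3/PDR with symmetry boosting: $F_0=\hat{Init}$; each frame $F_i$, $i>0$, is initialized to $\hat{P}$; and whenever a clause $\varphi$ is learned in frame $F_i$, the frame is updated as $F_i:=F_i\wedge\varphi^{L(G)}$. *)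

theory Defs
  imports Main "HOL-Library.FSet" "HOL-Combinatorics.Permutations"
begin

subsection \<open>Boolean formulas\<close>

datatype 'v fm = Var 'v | Neg "'v fm" | Conj "'v fm fset" | Disj "'v fm fset"

abbreviation And :: "'v fm \<Rightarrow> 'v fm \<Rightarrow> 'v fm" where
  "And \<psi> \<chi> \<equiv> Conj {|\<psi>, \<chi>|}"

primrec eval :: "('v \<Rightarrow> bool) \<Rightarrow> 'v fm \<Rightarrow> bool" where
  "eval v (Var x) = v x"
| "eval v (Neg \<psi>) = (\<not> eval v \<psi>)"
| "eval v (Conj \<Psi>) = fBall (eval v |`| \<Psi>) (\<lambda>b. b)"
| "eval v (Disj \<Psi>) = fBex (eval v |`| \<Psi>) (\<lambda>b. b)"

definition unsat :: "'v fm \<Rightarrow> bool" where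
  "unsat \<psi> \<longleftrightarrow> (\<nexists>v. eval v \<psi>)"

definition equivalent :: "'v fm \<Rightarrow> 'v fm \<Rightarrow> bool" where
  "equivalent \<psi> \<chi> \<longleftrightarrow> (\<forall>v. eval v \<psi> \<longleftrightarrow> eval v \<chi>)"

definition is_literal :: "'v fm \<Rightarrow> bool" where
  "is_literal l \<longleftrightarrow> (\<exists>x. l = Var x \<or> l = Neg (Var x))"

definition is_clause :: "'v fm \<Rightarrow> bool" where
  "is_clause \<psi> \<longleftrightarrow> (\<exists>L. \<psi> = Disj L \<and> fBall L is_literal)"

text \<open>Transition formulas speak about the current and the next-state copy of each state variable.\<close>

datatype 'v copy = Cur 'v | Nxt 'v

abbreviation unprimed :: "'v fm \<Rightarrow> 'v copy fm" where
  "unprimed \<equiv> map_fm Cur"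

abbreviation primed :: "'v fm \<Rightarrow> 'v copy fm" where
  "primed \<equiv> map_fm Nxt"


subsection \<open>Finite protocol instances\<close>

text \<open>
  A constant of an independent sort \<open>s\<close> is \<open>Basic s c\<close>; the tag keeps distinct independent sorts
  disjoint.  A constant of a dependent sort is identified with the object it names: a set (such as
  a quorum of nodes) or a tuple, built from constants of other sorts and possibly nested.  This
  makes the induced action of a permutation of the independent sorts a structural recursion.
\<close>

datatype ('s, 'c) const =
    Basic 's 'c
  | Subset "('s, 'c) const fset"
  | Tuple "('s, 'c) const list"

datatype ('s, 'd) sort = Indep 's | Dep 'd

datatype ('r, 's, 'c) svar = SVar 'r "('s, 'c) const list"

record ('s, 'd, 'r, 'c) protocol =
  indep_sorts :: "'s set"
  elems :: "'s \<Rightarrow> 'c set"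
  dep_sorts :: "'d set"
  dep_consts :: "'d \<Rightarrow> ('s, 'c) const set"
  rels :: "'r set"
  arg_sorts :: "'r \<Rightarrow> ('s, 'd) sort list"
  Init :: "('r, 's, 'c) svar fm"
  Trans :: "('r, 's, 'c) svar copy fm"
  Safe :: "('r, 's, 'c) svar fm"

definition sym_group :: "('s, 'd, 'r, 'c) protocol \<Rightarrow> ('s \<Rightarrow> 'c \<Rightarrow> 'c) set" where
  "sym_group P = {\<gamma>. (\<forall>s \<in> indep_sorts P. \<gamma> s permutes elems P s) \<and>
                      (\<forall>s. s \<notin> indep_sorts P \<longrightarrow> \<gamma> s = id)}"

primrec act_const :: "('s \<Rightarrow> 'c \<Rightarrow> 'c) \<Rightarrow> ('s, 'c) const \<Rightarrow> ('s, 'c) const" where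
  "act_const \<gamma> (Basic s c) = Basic s (\<gamma> s c)"
| "act_const \<gamma> (Subset X) = Subset (act_const \<gamma> |`| X)"
| "act_const \<gamma> (Tuple cs) = Tuple (map (act_const \<gamma>) cs)"

primrec act_svar :: "('s \<Rightarrow> 'c \<Rightarrow> 'c) \<Rightarrow> ('r, 's, 'c) svar \<Rightarrow> ('r, 's, 'c) svar" where
  "act_svar \<gamma> (SVar r cs) = SVar r (map (act_const \<gamma>) cs)"

definition act_fm :: "('s \<Rightarrow> 'c \<Rightarrow> 'c) \<Rightarrow> ('r, 's, 'c) svar fm \<Rightarrow> ('r, 's, 'c) svar fm" where
  "act_fm \<gamma> = map_fm (act_svar \<gamma>)"

definition act_trans ::
  "('s \<Rightarrow> 'c \<Rightarrow> 'c) \<Rightarrow> ('r, 's, 'c) svar copy fm \<Rightarrow> ('r, 's, 'c) svar copy fm" where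
  "act_trans \<gamma> = map_fm (map_copy (act_svar \<gamma>))"

text \<open>The objects that can be built from the constants of the independent sorts.\<close>

inductive_set objects :: "('s, 'd, 'r, 'c) protocol \<Rightarrow> ('s, 'c) const set"
  for P :: "('s, 'd, 'r, 'c) protocol" where
  "s \<in> indep_sorts P \<Longrightarrow> c \<in> elems P s \<Longrightarrow> Basic s c \<in> objects P"
| "(\<And>x. x |\<in>| X \<Longrightarrow> x \<in> objects P) \<Longrightarrow> Subset X \<in> objects P"
| "(\<And>x. x \<in> set cs \<Longrightarrow> x \<in> objects P) \<Longrightarrow> Tuple cs \<in> objects P"

fun sort_consts :: "('s, 'd, 'r, 'c) protocol \<Rightarrow> ('s, 'd) sort \<Rightarrow> ('s, 'c) const set" where
  "sort_consts P (Indep s) = Basic s ` elems P s"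
| "sort_consts P (Dep d) = dep_consts P d"

fun sort_declared :: "('s, 'd, 'r, 'c) protocol \<Rightarrow> ('s, 'd) sort \<Rightarrow> bool" where
  "sort_declared P (Indep s) \<longleftrightarrow> s \<in> indep_sorts P"
| "sort_declared P (Dep d) \<longleftrightarrow> d \<in> dep_sorts P"

definition svars :: "('s, 'd, 'r, 'c) protocol \<Rightarrow> ('r, 's, 'c) svar set" where
  "svars P = {SVar r cs | r cs. r \<in> rels P \<and>
                list_all2 (\<lambda>c \<tau>. c \<in> sort_consts P \<tau>) cs (arg_sorts P r)}"

text \<open>
  Invariance of the dependent sorts is what makes the induced map on their constants a permutation.
\<close>

definition finite_protocol :: "('s, 'd, 'r, 'c) protocol \<Rightarrow> bool" where
  "finite_protocol P \<longleftrightarrow>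
     finite (indep_sorts P) \<and> (\<forall>s \<in> indep_sorts P. finite (elems P s)) \<and>
     finite (dep_sorts P) \<and>
     (\<forall>d \<in> dep_sorts P. finite (dep_consts P d) \<and> dep_consts P d \<subseteq> objects P \<and>
        (\<forall>\<gamma> \<in> sym_group P. act_const \<gamma> ` dep_consts P d \<subseteq> dep_consts P d)) \<and>
     finite (rels P) \<and> (\<forall>r \<in> rels P. \<forall>\<tau> \<in> set (arg_sorts P r). sort_declared P \<tau>) \<and>
     set_fm (Init P) \<subseteq> svars P \<and>
     set_fm (Trans P) \<subseteq> Cur ` svars P \<union> Nxt ` svars P \<and>
     set_fm (Safe P) \<subseteq> svars P"

lemma finite_sym_group:
  assumes "finite_protocol P"
  shows "finite (sym_group P)"
proof -
  let ?Q = "Pi\<^sub>E (indep_sorts P) (\<lambda>s. {p. p permutes elems P s})"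
  let ?h = "\<lambda>f s. if s \<in> indep_sorts P then f s else id"
  have fin: "finite ?Q"
    using assms by (intro finite_PiE) (auto simp: finite_protocol_def finite_permutations)
  have "sym_group P \<subseteq> ?h ` ?Q"
  proof
    fix \<gamma> assume \<gamma>: "\<gamma> \<in> sym_group P"
    have "\<gamma> = ?h (restrict \<gamma> (indep_sorts P))"
      using \<gamma> by (auto simp: sym_group_def fun_eq_iff)
    moreover have "restrict \<gamma> (indep_sorts P) \<in> ?Q"
      using \<gamma> by (auto simp: sym_group_def)
    ultimately show "\<gamma> \<in> ?h ` ?Q" by blast
  qed
  with fin show ?thesis by (meson finite_imageI finite_subset)
qed

definition orbit :: "('s, 'd, 'r, 'c) protocol \<Rightarrow> ('r, 's, 'c) svar fm \<Rightarrow> ('r, 's, 'c) svar fm" where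
  "orbit P \<phi> = Conj (Abs_fset ((\<lambda>\<gamma>. act_fm \<gamma> \<phi>) ` sym_group P))"

lemma eval_orbit:
  assumes "finite_protocol P"
  shows "eval v (orbit P \<phi>) \<longleftrightarrow> (\<forall>\<gamma> \<in> sym_group P. eval v (act_fm \<gamma> \<phi>))"
  using finite_sym_group[OF assms]
  by (auto simp: orbit_def Abs_fset_inverse)


subsection \<open>Frames of SymIC3\<close>

text \<open>
  The possible contents \<open>[F\<^sub>0, F\<^sub>1, \<dots>]\<close> of the frame sequence during a run.  When a clause is
  learned, and in which frame, is left entirely open, so that every run is covered regardless of
  how its learned clauses are found, generalized or propagated.
\<close>

inductive symic3_frames ::
  "('s, 'd, 'r, 'c) protocol \<Rightarrow> ('r, 's, 'c) svar fm list \<Rightarrow> bool"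
  for P :: "('s, 'd, 'r, 'c) protocol" where
  start: "symic3_frames P [Init P]"
| new_frame: "symic3_frames P F \<Longrightarrow> symic3_frames P (F @ [Safe P])"
| learn: "symic3_frames P F \<Longrightarrow> 0 < i \<Longrightarrow> i < length F \<Longrightarrow> is_clause \<phi> \<Longrightarrow> set_fm \<phi> \<subseteq> svars P \<Longrightarrow>
    symic3_frames P (F[i := And (F ! i) (orbit P \<phi>)])"

end

(*
  Renaming the state variables of a formula amounts to precomposing its valuations.  Every frame is
  invariant under G: it is a conjunction of Init or Safe with logical orbits, and an orbit is
  invariant because G is closed under composition.  If a transition v leaves a frame and violates
  the orbit of phi, it violates the image of phi under some gamma in G; then v precomposed with
  gamma is again a transition from the frame, and it violates phi itself.
*)

theory Submission
  imports Defs
begin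

lemma eval_map_fm: "eval v (map_fm f \<psi>) \<longleftrightarrow> eval (v \<circ> f) \<psi>"
  by (induction \<psi>) auto

lemma eval_act_fm: "eval v (act_fm \<gamma> \<psi>) \<longleftrightarrow> eval (v \<circ> act_svar \<gamma>) \<psi>"
  by (simp add: act_fm_def eval_map_fm)

lemma act_const_compose:
  "act_const \<gamma> (act_const \<delta> c) = act_const (\<lambda>s. \<gamma> s \<circ> \<delta> s) c"
  by (induction c) (auto simp: fset.map_comp intro!: fset.map_cong0)

lemma act_svar_compose: "act_svar \<gamma> \<circ> act_svar \<delta> = act_svar (\<lambda>s. \<gamma> s \<circ> \<delta> s)"
proof
  fix x
  show "(act_svar \<gamma> \<circ> act_svar \<delta>) x = act_svar (\<lambda>s. \<gamma> s \<circ> \<delta> s) x"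
    by (cases x) (simp add: act_const_compose)
qed

lemma sym_group_compose:
  assumes "\<gamma> \<in> sym_group P" "\<delta> \<in> sym_group P"
  shows "(\<lambda>s. \<gamma> s \<circ> \<delta> s) \<in> sym_group P"
  using assms by (auto simp: sym_group_def intro: permutes_compose)

text \<open>Precomposing with \<open>act_svar \<gamma>\<close> turns the conjunct for
  \<open>\<delta>\<close> into the one for the composite of \<open>\<gamma>\<close> after
  \<open>\<delta>\<close>, again a conjunct of the orbit.\<close>

lemma eval_orbit_act:
  assumes "finite_protocol P" "\<gamma> \<in> sym_group P" "eval v (orbit P \<phi>)"
  shows "eval (v \<circ> act_svar \<gamma>) (orbit P \<phi>)"
  using assms
  by (auto simp: eval_orbit eval_act_fm comp_assoc act_svar_compose sym_group_compose)

lemma eval_frame_act: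
  assumes "symic3_frames P F" "finite_protocol P" "\<gamma> \<in> sym_group P"
    and "equivalent (act_fm \<gamma> (Init P)) (Init P)"
    and "equivalent (act_fm \<gamma> (Safe P)) (Safe P)"
    and "j < length F" "eval v (F ! j)"
  shows "eval (v \<circ> act_svar \<gamma>) (F ! j)"
  using assms
proof (induction arbitrary: j)
  case start
  then show ?case by (simp add: equivalent_def eval_act_fm comp_def)
next
  case (new_frame F)
  then show ?case
    by (cases "j < length F") (auto simp: nth_append equivalent_def eval_act_fm comp_def less_Suc_eq)
next
  case (learn F i \<phi>)
  \<comment> \<open>Only frame \<open>i\<close> changes: its old content is covered by the induction
    hypothesis, the new conjunct by \<open>eval_orbit_act\<close>.\<close>
  then show ?case by (cases "j = i") (auto dest: eval_orbit_act simp: comp_def)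
qed

theorem theorem1:
  fixes P :: "('s, 'd, 'r, 'c) protocol"
    and F :: "('r, 's, 'c) svar fm list"
    and \<phi> :: "('r, 's, 'c) svar fm"
    and i :: nat
  assumes "finite_protocol P"
    and "\<And>\<gamma>. \<gamma> \<in> sym_group P \<Longrightarrow> equivalent (act_fm \<gamma> (Init P)) (Init P)"
    and "\<And>\<gamma>. \<gamma> \<in> sym_group P \<Longrightarrow> equivalent (act_trans \<gamma> (Trans P)) (Trans P)"
    and "\<And>\<gamma>. \<gamma> \<in> sym_group P \<Longrightarrow> equivalent (act_fm \<gamma> (Safe P)) (Safe P)"
    and "symic3_frames P F"
    and "0 < i" and "i \<le> length F"
    and "is_clause \<phi>" and "set_fm \<phi> \<subseteq> svars P"
    and "unsat (And (And (unprimed (F ! (i - 1))) (Trans P)) (Neg (primed \<phi>)))"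
  shows "unsat (And (And (unprimed (F ! (i - 1))) (Trans P)) (Neg (primed (orbit P \<phi>))))"
  unfolding unsat_def
proof
  assume "\<exists>v. eval v (And (And (unprimed (F ! (i - 1))) (Trans P)) (Neg (primed (orbit P \<phi>))))"
  then obtain v where frame: "eval (v \<circ> Cur) (F ! (i - 1))" and trans: "eval v (Trans P)"
    and "\<not> eval (v \<circ> Nxt) (orbit P \<phi>)"
    by (auto simp: eval_map_fm)
  then obtain \<gamma> where \<gamma>: "\<gamma> \<in> sym_group P"
    and viol: "\<not> eval (v \<circ> Nxt \<circ> act_svar \<gamma>) \<phi>"
    using assms(1) by (auto simp: eval_orbit eval_act_fm)
  \<comment> \<open>The same \<open>\<gamma>\<close> must act on both copies, since the invariance
    of \<open>Trans P\<close> concerns the simultaneous renaming of current and next states.\<close>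
  define w where "w = v \<circ> map_copy (act_svar \<gamma>)"
  have "w \<circ> Cur = v \<circ> Cur \<circ> act_svar \<gamma>" and "w \<circ> Nxt = v \<circ> Nxt \<circ> act_svar \<gamma>"
    by (auto simp: w_def)
  \<comment> \<open>The bounds \<open>0 < i\<close> and \<open>i \<le> length F\<close> make
    \<open>i - 1\<close> a valid frame index.\<close>
  moreover have "eval (v \<circ> Cur \<circ> act_svar \<gamma>) (F ! (i - 1))"
    using assms(1-7) \<gamma> frame by (intro eval_frame_act) auto
  \<comment> \<open>By the choice of \<open>w\<close>, this says that \<open>v\<close> satisfies
    \<open>act_trans \<gamma> (Trans P)\<close>.\<close>
  moreover have "eval w (Trans P)"
    using assms(3)[OF \<gamma>] trans by (simp add: equivalent_def act_trans_def eval_map_fm w_def)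
  ultimately have "eval w (And (And (unprimed (F ! (i - 1))) (Trans P)) (Neg (primed \<phi>)))"
    using viol by (simp add: eval_map_fm)
  with assms(10) show False by (auto simp: unsat_def)
qed

end
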